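(* Let $R>0$ and $\kappa>0$. For $n\in\mathbb{N}_+=\{1,2,3,\dots\}$ set the threshold $$\eta_n=\frac{2\,|J_1(j_{2,n})|}{j_{2,n}} .$$ Then, with threshold $\eta_n$, the spatial resolution of the circular surface of radius $R$ is $$\bar\chi=\frac{j_{2,n}}{\kappa R};$$ that is, for any two users $k,k'$ with $\chi_{kk'}>\dfrac{j_{2,n}}{\kappa R}$ one has $\tilde\Sigma^{\mathcal{S}}_{kk'}<\eta_n$.
   Context: $j$ (without index) is the imaginary unit, $^*$ denotes complex conjugation, $J_m$ is the Bessel function of the first kind of order $m$, and $j_{m,n}$ is the $n$-th positive zero of $J_m$. A circular surface occupies $\mathcal{S}=\{(x,y): x^2+y^2\le R^2\}$ in the $xy$-plane. User $k$ is at $(x_k,y_k,z_k)\in\mathbb{R}^3$ with $z_k>0$, and $d_k^c=\sqrt{x_k^2+y_k^2+z_k^2}$. $\kappa=2\pi/\lambda$ with $\lambda>0$ the wavelength; $\varphi_k\in[-\pi,\pi]$ is a phase of user $k$. In the far-field (plane-wave) model the channel response of user $k$ at $(x,y,0)$ is $$h_k(x,y)=\exp\!\Big(-j\Big(\kappa d_k^c+\kappa\,\frac{y_k\,y-x_k\,x}{d_k^c}+\varphi_k\Big)\Big).$$ The effective channel is $\Sigma^{\mathcal{S}}_{kk'}=\iint_{\mathcal{S}}h_k^*(x,y)h_{k'}(x,y)\,dx\,dy$, and $\tilde\Sigma^{\mathcal{S}}_{kk'}=\left|\Sigma^{\mathcal{S}}_{kk'}/\Sigma^{\mathcal{S}}_{kk}\right|$.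 Put $\eta_{kk'}=\frac{x_k}{d_k^c}-\frac{x_{k'}}{d_{k'}^c}$, $\xi_{kk'}=\frac{y_k}{d_k^c}-\frac{y_{k'}}{d_{k'}^c}$, $\chi_{kk'}=\sqrt{\eta_{kk'}^2+\xi_{kk'}^2}\ge0$. Spatial resolution (definition): for a small threshold $\eta>0$, $\bar\chi$ is the spatial resolution if for any two users $k,k'$ with $\chi_{kk'}>\bar\chi$ one has $\tilde\Sigma^{\mathcal{S}}_{kk'}<\eta$. *)

theory Defs
  imports "HOL-Analysis.Analysis"
begin

text \<open>Bessel function of the first kind of integer order \<open>m \<ge> 0\<close> on the real line, by its
  everywhere convergent power series.\<close>

definition bessel_J :: "nat \<Rightarrow> real \<Rightarrow> real" where
  "bessel_J m x = (\<Sum>k. (-1) ^ k / (fact k * fact (k + m)) * (x / 2) ^ (2 * k + m))"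

text \<open>The \<open>n\<close>-th positive zero, counted from \<open>n = 1\<close>: the positive zero with exactly \<open>n\<close> zeros in
  \<open>(0, x]\<close>.  The value at \<open>n = 0\<close> is unspecified.  Zeros are counted without multiplicity, which is
  no restriction because the positive zeros of a Bessel function are simple.\<close>

definition bessel_J_zero :: "nat \<Rightarrow> nat \<Rightarrow> real" where
  "bessel_J_zero m n =
     (THE x. 0 < x \<and> bessel_J m x = 0 \<and> card {t. 0 < t \<and> t \<le> x \<and> bessel_J m t = 0} = n)"

record user =
  xpos :: real
  ypos :: real
  zpos :: real
  phase :: real

definition admissible_user :: "user \<Rightarrow> bool" where
  "admissible_user k \<longleftrightarrow> 0 < zpos k \<and> - pi \<le> phase k \<and> phase k \<le> pi"

definition center_dist :: "user \<Rightarrow> real" where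
  "center_dist k = sqrt ((xpos k)\<^sup>2 + (ypos k)\<^sup>2 + (zpos k)\<^sup>2)"

definition circular_surface :: "real \<Rightarrow> (real \<times> real) set" where
  "circular_surface R = {(x, y). x\<^sup>2 + y\<^sup>2 \<le> R\<^sup>2}"

definition channel :: "real \<Rightarrow> user \<Rightarrow> real \<times> real \<Rightarrow> complex" where
  "channel \<kappa> k = (\<lambda>(x, y). exp (- \<i> * complex_of_real
     (\<kappa> * center_dist k + \<kappa> * ((ypos k * y - xpos k * x) / center_dist k) + phase k)))"

definition effective_channel :: "real \<Rightarrow> (real \<times> real) set \<Rightarrow> user \<Rightarrow> user \<Rightarrow> complex" where
  "effective_channel \<kappa> S k k' = (LINT p:S|lborel. cnj (channel \<kappa> k p) * channel \<kappa> k' p)"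

definition normalized_channel :: "real \<Rightarrow> (real \<times> real) set \<Rightarrow> user \<Rightarrow> user \<Rightarrow> real" where
  "normalized_channel \<kappa> S k k' = cmod (effective_channel \<kappa> S k k' / effective_channel \<kappa> S k k)"

definition eta_diff :: "user \<Rightarrow> user \<Rightarrow> real" where
  "eta_diff k k' = xpos k / center_dist k - xpos k' / center_dist k'"

definition xi_diff :: "user \<Rightarrow> user \<Rightarrow> real" where
  "xi_diff k k' = ypos k / center_dist k - ypos k' / center_dist k'"

definition chi_diff :: "user \<Rightarrow> user \<Rightarrow> real" where
  "chi_diff k k' = sqrt ((eta_diff k k')\<^sup>2 + (xi_diff k k')\<^sup>2)"

text \<open>Spatial resolution of a surface \<open>S\<close> for the threshold \<open>\<eta>\<close>.  The notion is a sufficiency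
  condition: it does not ask for the least such \<open>r\<close>.\<close>

definition spatial_resolution :: "real \<Rightarrow> (real \<times> real) set \<Rightarrow> real \<Rightarrow> real \<Rightarrow> bool" where
  "spatial_resolution \<kappa> S \<eta> r \<longleftrightarrow> 0 < \<eta> \<and>
     (\<forall>k k'. admissible_user k \<longrightarrow> admissible_user k' \<longrightarrow> chi_diff k k' > r \<longrightarrow>
        normalized_channel \<kappa> S k k' < \<eta>)"

definition resolution_threshold :: "nat \<Rightarrow> real" where
  "resolution_threshold n = 2 * \<bar>bessel_J 1 (bessel_J_zero 2 n)\<bar> / bessel_J_zero 2 n"

end

theory Submission
  imports Defs
begin

text \<open>The normalized channel is \<open>\<bar>2 J\<^sub>1(u) / u\<bar>\<close> at \<open>u = \<kappa> R \<chi>\<close>: after a rotation of the disc, the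
  integral of the plane wave reduces to the cosine transform of \<open>sqrt (R\<^sup>2 - x\<^sup>2)\<close>, which is expanded
  into moments. In the variable \<open>t = u\<^sup>2 / 4\<close> the functions \<open>\<phi>\<^sub>m(t) = (u / 2)\<^bsup>-m\<^esup> J\<^sub>m(u)\<close> are entire and
  satisfy \<open>\<phi>\<^sub>m' = - \<phi>\<^bsub>m+1\<^esub>\<close>, and \<open>2 J\<^sub>1(u) / u = \<phi>\<^sub>1(t)\<close>. The energy \<open>E = \<phi>\<^sub>1\<^sup>2 + t \<phi>\<^sub>2\<^sup>2\<close> has derivative
  \<open>- 3 \<phi>\<^sub>2\<^sup>2\<close>, so it decreases strictly, and it equals \<open>\<phi>\<^sub>1\<^sup>2\<close> at the zeros of \<open>\<phi>\<^sub>2\<close>. Hence beyond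
  a zero of \<open>J\<^sub>2\<close> the function \<open>\<bar>\<phi>\<^sub>1\<bar>\<close> stays below its value at that zero.\<close>

subsection \<open>Bessel functions and the energy\<close>

text \<open>This is \<open>\<phi>\<^sub>m\<close> of the overview, the Bessel-Clifford function at
  \<open>- t\<close>. With \<open>t = u^2 / 4\<close> the factor \<open>(u / 2)^m\<close> of
  \<open>J\<^sub>m\<close> splits off, which leaves a function that is smooth and nonzero at
  0.\<close>

definition bessel_series :: "nat \<Rightarrow> real \<Rightarrow> real" where
  "bessel_series m t = (\<Sum>k. (-1) ^ k / (fact k * fact (k + m)) * t ^ k)"

lemma summable_bessel_series:
  "summable (\<lambda>k. (-1) ^ k / (fact k * fact (k + m)) * t ^ k :: real)"
proof (rule summable_comparison_test')
  show "summable (\<lambda>k. norm (t ^ k /\<^sub>R fact k))"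
    by (rule summable_norm_exp)
  show "norm ((-1) ^ k / (fact k * fact (k + m)) * t ^ k) \<le> norm (t ^ k /\<^sub>R fact k)" for k
  proof -
    have "(fact k :: real) * 1 \<le> fact k * fact (k + m)"
      by (intro mult_left_mono) auto
    then show ?thesis
      using mult_right_mono[of 1 "fact (k + m) :: real" "\<bar>t\<bar> ^ k"]
      by (simp add: abs_mult power_abs divide_simps mult.commute)
  qed
qed

lemma bessel_series_0 [simp]: "bessel_series m 0 = 1 / fact m"
  unfolding bessel_series_def by (subst powser_zero) auto

lemma bessel_J_eq: "bessel_J m x = (x / 2) ^ m * bessel_series m (x\<^sup>2 / 4)"
proof -
  have "(x / 2) ^ (2 * k + m) = (x / 2) ^ m * (x\<^sup>2 / 4) ^ k" for k
    by (simp add: power_add power_mult) (simp add: power2_eq_square)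
  then show ?thesis
    unfolding bessel_J_def bessel_series_def
    by (subst suminf_mult[OF summable_bessel_series, symmetric]) (simp add: mult_ac)
qed

text \<open>Comparison of coefficients: the three-term recurrence of the Bessel functions in the
  variable \<open>t\<close>. The constant terms on the right cancel, so that series may start at
  index 1.\<close>

lemma bessel_series_rec:
  "t * bessel_series (m + 2) t = real (m + 1) * bessel_series (m + 1) t - bessel_series m t"
proof -
  let ?c = "\<lambda>m k. (-1) ^ k / (fact k * fact (k + m)) :: real"
  have S: "(\<lambda>k. ?c m k * t ^ k) sums bessel_series m t" for m
    unfolding bessel_series_def using summable_bessel_series by (rule summable_sums)
  have "(\<lambda>k. real (m + 1) * (?c (m + 1) k * t ^ k) - ?c m k * t ^ k) sums
      (real (m + 1) * bessel_series (m + 1) t - bessel_series m t)"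
    by (intro sums_diff sums_mult S)
  moreover have "(\<lambda>k. real (m + 1) * (?c (m + 1) k * t ^ k) - ?c m k * t ^ k) sums
      (t * bessel_series (m + 2) t)"
  proof -
    have "(\<lambda>k. t * (?c (m + 2) k * t ^ k)) sums (t * bessel_series (m + 2) t)"
      by (intro sums_mult S)
    moreover have "t * (?c (m + 2) k * t ^ k) =
       real (m + 1) * (?c (m + 1) (Suc k) * t ^ Suc k) - ?c m (Suc k) * t ^ Suc k" for k
    proof -
      have F: "fact (Suc k + (m + 1)) = (real k + real m + 2) * (fact (k + m + 1) :: real)"
        "fact (k + (m + 2)) = (real k + real m + 2) * (fact (k + m + 1) :: real)"
        "fact (Suc k + m) = (fact (k + m + 1) :: real)"
        "fact (Suc k) = (real k + 1) * (fact k :: real)"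
        using fact_Suc[of "k + m + 1", where 'a = real] fact_Suc[of k, where 'a = real]
        by (simp_all add: add_ac del: fact_Suc)
      \<comment> \<open>The coefficient identity reduces to
        \<open>(A - B) / (A * B) - 1 / B = - 1 / A\<close>.\<close>
      define A B where "A = real k + real m + 2" and "B = real k + 1"
      have "A \<noteq> 0" "B \<noteq> 0" "real (m + 1) = A - B"
        by (simp_all add: A_def B_def)
      then show ?thesis
        unfolding F A_def[symmetric] B_def[symmetric]
        by (simp add: divide_simps del: fact_Suc) (simp add: algebra_simps)
    qed
    ultimately have "(\<lambda>k. real (m + 1) * (?c (m + 1) (Suc k) * t ^ Suc k) - ?c m (Suc k) * t ^ Suc k)
        sums (t * bessel_series (m + 2) t)"
      by simp
    then show ?thesis
      by (subst (asm) sums_Suc_iff) simp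
  qed
  ultimately show ?thesis
    using sums_unique2 by blast
qed

lemma DERIV_bessel_series:
  "(bessel_series m has_real_derivative - bessel_series (Suc m) t) (at t)"
proof -
  let ?c = "\<lambda>m k. (-1) ^ k / (fact k * fact (k + m)) :: real"
  have "diffs (?c m) k = - ?c (Suc m) k" for k
  proof -
    have "diffs (?c m) k = (real k + 1) * (- ((-1) ^ k) / ((real k + 1) * fact k * fact (Suc k + m)))"
      by (simp add: diffs_def add.commute)
    also have "\<dots> = - ?c (Suc m) k"
      by (simp del: fact_Suc)
    finally show ?thesis .
  qed
  then have "diffs (?c m) = (\<lambda>k. - ?c (Suc m) k)"
    by auto
  then show ?thesis
    using termdiffs_strong_converges_everywhere[OF summable_bessel_series, of m t]
      suminf_minus[OF summable_bessel_series, of "Suc m" t]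
    unfolding bessel_series_def[abs_def] by simp
qed

lemmas DERIV_bessel_series' [derivative_intros] = DERIV_chain2[OF DERIV_bessel_series]

lemma continuous_on_bessel_series [continuous_intros]:
  "continuous_on S (bessel_series m)"
  by (meson DERIV_bessel_series DERIV_continuous continuous_at_imp_continuous_on)

text \<open>The product rule produces exactly the right-hand side of the recurrence. This formula
  lets the sign of one index control the growth of the next.\<close>

lemma DERIV_power_bessel_series:
  "((\<lambda>t. t ^ Suc m * bessel_series (Suc m) t) has_real_derivative t ^ m * bessel_series m t) (at t)"
proof -
  have "((\<lambda>t. t ^ Suc m * bessel_series (Suc m) t) has_real_derivative
      t ^ m * (real (m + 1) * bessel_series (m + 1) t - t * bessel_series (m + 2) t)) (at t)"
    by (rule derivative_eq_intros refl)+ (simp add: algebra_simps)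
  then show ?thesis
    unfolding bessel_series_rec by simp
qed

section \<open>The energy and the simplicity of the zeros\<close>

definition bessel_energy :: "real \<Rightarrow> real" where
  "bessel_energy t = (bessel_series 1 t)\<^sup>2 + t * (bessel_series 2 t)\<^sup>2"

text \<open>For \<open>t = u^2 / 4\<close> and \<open>u\<close> nonzero the energy is
  \<open>4 * (J\<^sub>1(u)^2 + J\<^sub>2(u)^2) / u^2\<close>. Eliminating index 3 by the recurrence
  cancels the mixed terms of its derivative.\<close>

lemma DERIV_bessel_energy:
  "(bessel_energy has_real_derivative - 3 * (bessel_series 2 t)\<^sup>2) (at t)"
proof -
  have r: "t * bessel_series 3 t = 2 * bessel_series 2 t - bessel_series 1 t"
    using bessel_series_rec[of t 1] by (simp add: numeral_eq_Suc)
  have "((\<lambda>t. (bessel_series 1 t)\<^sup>2 + t * (bessel_series 2 t)\<^sup>2) has_real_derivative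
      - 2 * bessel_series 1 t * bessel_series 2 t + (bessel_series 2 t)\<^sup>2
      - 2 * (t * bessel_series 3 t) * bessel_series 2 t) (at t)"
    by (rule derivative_eq_intros refl | simp add: eval_nat_numeral)+
  then show ?thesis
    unfolding bessel_energy_def[abs_def] r by (simp add: algebra_simps power2_eq_square)
qed

lemma bessel_energy_antimono: "s \<le> t \<Longrightarrow> bessel_energy t \<le> bessel_energy s"
  using DERIV_nonpos_imp_nonincreasing[of s t bessel_energy] DERIV_bessel_energy
  by (metis mult_nonpos_nonneg neg_le_0_iff_le zero_le_numeral zero_le_power2)

lemma bessel_energy_pos:
  assumes "0 \<le> t"
  shows "0 < bessel_energy t"
  \<comment> \<open>\<open>t\<^sup>3 E\<close> is nondecreasing, so a zero of \<open>E\<close> would propagate down to \<open>E(0) = 1\<close>.\<close>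
proof (rule ccontr)
  assume "\<not> 0 < bessel_energy t"
  have nn: "0 \<le> bessel_energy s" if "0 \<le> s" for s
    using that by (simp add: bessel_energy_def)
  \<comment> \<open>The weight \<open>t ^ 3\<close> is chosen so that the term
    \<open>- 3 * (bessel_series 2 s)^2\<close> is compensated and only a square remains.\<close>
  have D: "((\<lambda>t. t ^ 3 * bessel_energy t) has_real_derivative 3 * s\<^sup>2 * (bessel_series 1 s)\<^sup>2) (at s)" for s
    by (rule derivative_eq_intros refl DERIV_bessel_energy)+
       (simp add: bessel_energy_def algebra_simps eval_nat_numeral)
  have zero: "bessel_energy s = 0" if "0 < s" "s \<le> t" for s
  proof -
    have "s ^ 3 * bessel_energy s \<le> t ^ 3 * bessel_energy t"
    proof (rule DERIV_nonneg_imp_nondecreasing[OF \<open>s \<le> t\<close>])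
      show "\<exists>y. ((\<lambda>t. t ^ 3 * bessel_energy t) has_real_derivative y) (at x) \<and> 0 \<le> y" for x
        by (rule exI conjI D)+ simp
    qed
    also have "\<dots> \<le> 0"
      using \<open>\<not> 0 < bessel_energy t\<close> \<open>0 \<le> t\<close> by (simp add: mult_nonneg_nonpos)
    finally show ?thesis
      using nn[of s] that by (simp add: mult_le_0_iff)
  qed
  have "bessel_energy 0 = 1"
    by (simp add: bessel_energy_def)
  with \<open>\<not> 0 < bessel_energy t\<close> \<open>0 \<le> t\<close> have "0 < t"
    by (cases "t = 0") auto
  \<comment> \<open>The weight vanishes at 0, so the energy is known to be 0 only on
    \<open>(0, t]\<close>; continuity at 0 carries this over to the value 1 there.\<close>
  have "bessel_energy \<midarrow>0\<rightarrow> bessel_energy 0"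
    using DERIV_isCont[OF DERIV_bessel_energy[of 0]] by (simp add: isCont_def)
  then have "(bessel_energy \<longlongrightarrow> 1) (at_right 0)"
    using \<open>bessel_energy 0 = 1\<close> by (simp add: filterlim_at_split)
  moreover have "\<forall>\<^sub>F s in at_right 0. bessel_energy s = 0"
    using eventually_at_right_real[OF \<open>0 < t\<close>] by eventually_elim (auto intro: zero)
  ultimately have "((\<lambda>s. 0) \<longlongrightarrow> (1::real)) (at_right (0::real))"
    by (rule Lim_transform_eventually)
  then show False
    using tendsto_const_iff[of "at_right (0::real)" 0 "1::real"] by simp
qed

text \<open>A common zero would annihilate the energy. This yields both the simplicity of the zeros
  and the positivity of the threshold.\<close>

lemma bessel_series_1_neq_0:
  assumes "0 \<le> t" "bessel_series 2 t = 0"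
  shows "bessel_series 1 t \<noteq> 0"
  using bessel_energy_pos[OF \<open>0 \<le> t\<close>] assms(2) by (auto simp: bessel_energy_def)

text \<open>Up to sign, index 3 is the derivative of index 2, so the zeros are simple. At a zero the
  recurrence reads \<open>t * bessel_series 3 t = - bessel_series 1 t\<close>.\<close>

lemma bessel_series_2_simple_zero:
  assumes "0 \<le> t" "bessel_series 2 t = 0"
  shows "bessel_series 3 t \<noteq> 0"
  using bessel_series_1_neq_0[OF assms] bessel_series_rec[of t 1] assms(2)
  by (auto simp: numeral_eq_Suc)

text \<open>Infinitely many zeros in a bounded interval accumulate at some zero \<open>t\<close>.
  Difference quotients along them vanish, so the derivative at \<open>t\<close> is 0, against
  simplicity.\<close>

lemma finite_zeros_bessel_series_2:
  "finite {t. 0 \<le> t \<and> t \<le> b \<and> bessel_series 2 t = 0}" (is "finite ?Z")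
proof (rule ccontr)
  assume "infinite ?Z"
  moreover have "?Z \<subseteq> {0..b}"
    by auto
  ultimately obtain t where t: "t \<in> {0..b}" "t islimpt ?Z"
    using Heine_Borel_imp_Bolzano_Weierstrass[OF compact_Icc] by blast
  then obtain X where X: "\<And>n. X n \<in> ?Z - {t}" "X \<longlonglongrightarrow> t"
    unfolding islimpt_sequential by blast
  have "(\<lambda>n. bessel_series 2 (X n)) \<longlonglongrightarrow> bessel_series 2 t"
    using X(2) by (rule isCont_tendsto_compose[OF DERIV_isCont[OF DERIV_bessel_series]])
  with X(1) have z: "bessel_series 2 t = 0"
    by (simp add: LIMSEQ_const_iff)
  have "((\<lambda>s. (bessel_series 2 s - bessel_series 2 t) / (s - t)) \<longlongrightarrow> - bessel_series 3 t) (at t)"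
    using DERIV_bessel_series[of 2 t] by (simp add: has_field_derivative_iff eval_nat_numeral)
  moreover have "filterlim X (at t) sequentially"
    using X by (auto simp: filterlim_at)
  ultimately have "(\<lambda>n. (bessel_series 2 (X n) - bessel_series 2 t) / (X n - t)) \<longlonglongrightarrow> - bessel_series 3 t"
    by (rule filterlim_compose)
  moreover have "(\<lambda>n. (bessel_series 2 (X n) - bessel_series 2 t) / (X n - t)) = (\<lambda>n. 0)"
    using X(1) z by auto
  ultimately have "bessel_series 3 t = 0"
    by (simp add: LIMSEQ_const_iff)
  with bessel_series_2_simple_zero[OF _ z] t(1) show False
    by simp
qed

text \<open>Without a strict drop the energy is constant on \<open>[s, t]\<close>, its derivative
  vanishes inside, and \<open>bessel_series 2\<close> has infinitely many zeros there.\<close>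

lemma bessel_energy_strict_antimono:
  assumes "0 \<le> s" "s < t"
  shows "bessel_energy t < bessel_energy s"
proof (rule ccontr)
  assume *: "\<not> bessel_energy t < bessel_energy s"
  have const: "bessel_energy r = bessel_energy s" if "r \<in> {s..t}" for r
    using bessel_energy_antimono[of s r] bessel_energy_antimono[of r t] * that by auto
  have "bessel_series 2 r = 0" if "r \<in> {s<..<t}" for r
  proof -
    have "(bessel_energy has_real_derivative 0) (at r)"
    proof (rule has_field_derivative_transform_within_open[OF DERIV_const])
      show "open {s<..<t}" "r \<in> {s<..<t}" "\<And>x. x \<in> {s<..<t} \<Longrightarrow> bessel_energy s = bessel_energy x"
        using that by (auto intro: const[symmetric])
    qed
    from DERIV_unique[OF this DERIV_bessel_energy] show ?thesis
      by simp
  qed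
  then have "{s<..<t} \<subseteq> {r. 0 \<le> r \<and> r \<le> t \<and> bessel_series 2 r = 0}"
    using assms by auto
  from finite_subset[OF this finite_zeros_bessel_series_2] show False
    using infinite_Ioo[OF \<open>s < t\<close>] by simp
qed

lemma bessel_series_1_decay:
  assumes "0 \<le> s" "s < t" "bessel_series 2 s = 0"
  shows "\<bar>bessel_series 1 t\<bar> < \<bar>bessel_series 1 s\<bar>"
proof -
  have "(bessel_series 1 t)\<^sup>2 \<le> bessel_energy t"
    using assms by (simp add: bessel_energy_def)
  also have "\<dots> < bessel_energy s"
    using assms by (intro bessel_energy_strict_antimono)
  also have "\<dots> = (bessel_series 1 s)\<^sup>2"
    using assms by (simp add: bessel_energy_def)
  finally show ?thesis
    by (metis abs_ge_zero power2_abs power_less_imp_less_base)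
qed

section \<open>Unboundedness of the zeros\<close>

lemma linear_decrease_unbounded:
  fixes f f' :: "real \<Rightarrow> real"
  assumes D: "\<And>t. a \<le> t \<Longrightarrow> (f has_real_derivative f' t) (at t)"
    and le: "\<And>t. a \<le> t \<Longrightarrow> f' t \<le> - e" and "0 < e"
  shows "\<exists>t\<ge>a. f t < 0"
proof -
  \<comment> \<open>A slope of at most \<open>- e\<close> over this length makes \<open>f\<close>
    drop by at least \<open>\<bar>f a\<bar> + 1\<close>.\<close>
  define b where "b = a + (\<bar>f a\<bar> + 1) / e"
  have "a < b"
    using \<open>0 < e\<close> by (simp add: b_def add_pos_nonneg add_nonneg_pos)
  with MVT2[of a b f f'] D obtain z where z: "a < z" "f b - f a = (b - a) * f' z"
    by auto
  have "(b - a) * f' z \<le> (b - a) * (- e)"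
    using le[of z] z(1) \<open>a < b\<close> by (intro mult_left_mono) auto
  also have "\<dots> = - (\<bar>f a\<bar> + 1)"
    using \<open>0 < e\<close> by (simp add: b_def)
  finally have "f b < 0"
    using z(2) by linarith
  with \<open>a < b\<close> show ?thesis
    by (auto intro!: exI[of _ b])
qed

text \<open>If \<open>c \<phi>\<^sub>m\<close> became nonpositive, it would be bounded away from 0 thereafter, and
  \<open>(t\<^bsup>m+1\<^esup> \<phi>\<^bsub>m+1\<^esub>)' = t\<^sup>m \<phi>\<^sub>m\<close> would drive \<open>c \<phi>\<^bsub>m+1\<^esub>\<close> below 0.\<close>

lemma bessel_series_eventually_pos_lower:
  assumes "1 \<le> a" and pos: "\<And>t. a \<le> t \<Longrightarrow> 0 < c * bessel_series (Suc m) t" and "a \<le> t"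
  shows "0 < c * bessel_series m t"
proof (rule ccontr)
  assume np: "\<not> 0 < c * bessel_series m t"
  have dec: "c * bessel_series m v < c * bessel_series m u" if "a \<le> u" "u < v" for u v
  proof (rule DERIV_neg_imp_decreasing[OF \<open>u < v\<close>])
    fix x assume "u \<le> x"
    with pos[of x] that show "\<exists>y. ((\<lambda>t. c * bessel_series m t) has_real_derivative y) (at x) \<and> y < 0"
      by (intro exI[of _ "c * - bessel_series (Suc m) x"] conjI DERIV_cmult DERIV_bessel_series) auto
  qed
  \<comment> \<open>At \<open>t\<close> itself the value may be 0; one unit further the strict
    decrease makes it negative.\<close>
  define e where "e = - (c * bessel_series m (t + 1))"
  have "0 < e"
    using dec[of t "t + 1"] \<open>a \<le> t\<close> np by (simp add: e_def)
  have "\<exists>s\<ge>t+1. c * (s ^ Suc m * bessel_series (Suc m) s) < 0"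
  proof (rule linear_decrease_unbounded[OF _ _ \<open>0 < e\<close>])
    fix s assume s: "t + 1 \<le> s"
    show "((\<lambda>s. c * (s ^ Suc m * bessel_series (Suc m) s)) has_real_derivative
        c * (s ^ m * bessel_series m s)) (at s)"
      by (intro DERIV_cmult DERIV_power_bessel_series)
    have "e \<le> - (c * bessel_series m s)"
      using dec[of "t + 1" s] s \<open>a \<le> t\<close> by (cases "s = t + 1") (auto simp: e_def)
    moreover have "1 \<le> s ^ m"
      using s \<open>a \<le> t\<close> \<open>1 \<le> a\<close> by (intro one_le_power) auto
    ultimately have "1 * e \<le> s ^ m * (- (c * bessel_series m s))"
      using \<open>0 < e\<close> by (intro mult_mono) auto
    then show "c * (s ^ m * bessel_series m s) \<le> - e"
      by (simp add: algebra_simps)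
  qed
  then obtain s where s: "t + 1 \<le> s" "c * (s ^ Suc m * bessel_series (Suc m) s) < 0"
    by auto
  have "0 < s ^ Suc m * (c * bessel_series (Suc m) s)"
    using s(1) \<open>a \<le> t\<close> \<open>1 \<le> a\<close> pos[of s] by (intro mult_pos_pos[of "s ^ Suc m"]) auto
  with s(2) show False
    by (simp add: algebra_simps)
qed

text \<open>The descent to lower indices stops at 0, so a contradiction is drawn there from
  logarithmic divergence.\<close>

lemma bessel_series_1_not_eventually_pos:
  assumes "1 \<le> a"
  shows "\<exists>t\<ge>a. c * bessel_series 1 t \<le> 0"
proof (rule ccontr)
  assume "\<not> ?thesis"
  then have pos1: "0 < c * bessel_series 1 t" if "a \<le> t" for t
    using that by force
  then have pos0: "0 < c * bessel_series 0 t" if "a \<le> t" for t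
    using bessel_series_eventually_pos_lower[OF \<open>1 \<le> a\<close>, of c 0 t] that by simp
  txt \<open>Now \<open>t \<phi>\<^sub>1\<close> grows, so \<open>\<phi>\<^sub>0' = - \<phi>\<^sub>1\<close> is at most \<open>- e / t\<close> and \<open>\<phi>\<^sub>0\<close> diverges like
    \<open>- ln t\<close>.\<close>
  define e where "e = c * (a * bessel_series 1 a)"
  have "0 < e"
    using pos1[of a] \<open>1 \<le> a\<close> by (simp add: e_def algebra_simps zero_less_mult_iff)
  have e_le: "e \<le> c * (t * bessel_series 1 t)" if "a \<le> t" for t
    unfolding e_def
  proof (rule DERIV_nonneg_imp_nondecreasing[OF that])
    fix x assume "a \<le> x"
    with pos0[of x] DERIV_power_bessel_series[of 0 x]
    show "\<exists>y. ((\<lambda>t. c * (t * bessel_series 1 t)) has_real_derivative y) (at x) \<and> 0 \<le> y"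
      by (intro exI[of _ "c * bessel_series 0 x"] conjI DERIV_cmult) auto
  qed
  \<comment> \<open>The substitution \<open>t = exp u\<close> turns the slope bound
    \<open>- e / t\<close> into the constant bound \<open>- e\<close>.\<close>
  let ?f = "\<lambda>u. c * bessel_series 0 (exp u)"
  have "\<exists>u\<ge>ln a. ?f u < 0"
  proof (rule linear_decrease_unbounded[OF _ _ \<open>0 < e\<close>])
    fix u assume u: "ln a \<le> u"
    show "(?f has_real_derivative - (c * (exp u * bessel_series 1 (exp u)))) (at u)"
      by (rule derivative_eq_intros refl | simp)+
    have "a \<le> exp u"
      using u \<open>1 \<le> a\<close> by (metis exp_le_cancel_iff exp_ln zero_less_one order_less_le_trans)
    then show "- (c * (exp u * bessel_series 1 (exp u))) \<le> - e"
      using e_le by simp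
  qed
  then obtain u where u: "ln a \<le> u" "?f u < 0"
    by auto
  moreover have "a \<le> exp u"
    using u \<open>1 \<le> a\<close> by (metis exp_le_cancel_iff exp_ln zero_less_one order_less_le_trans)
  ultimately show False
    using pos0[of "exp u"] by simp
qed

text \<open>Without zeros beyond \<open>b\<close> the sign is eventually constant; it passes down to
  index 1, where a constant sign is impossible.\<close>

lemma bessel_series_2_zeros_unbounded: "\<exists>t\<ge>b. bessel_series 2 t = 0"
proof (rule ccontr)
  assume *: "\<not> ?thesis"
  define a where "a = max 1 b"
  have nz: "bessel_series 2 t \<noteq> 0" if "a \<le> t" for t
    using * that by (auto simp: a_def)
  \<comment> \<open>Multiplication by the sign at \<open>a\<close> treats both signs at
    once.\<close>
  define c where "c = sgn (bessel_series 2 a)"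
  have "0 < c * bessel_series 2 t" if "a \<le> t" for t
  proof (rule ccontr)
    assume "\<not> 0 < c * bessel_series 2 t"
    moreover have "0 < c * bessel_series 2 a"
      using nz[of a] by (simp add: c_def mult.commute flip: abs_sgn)
    ultimately have "\<exists>s\<ge>a. s \<le> t \<and> c * bessel_series 2 s = 0"
      using that by (intro IVT2') (auto intro!: continuous_intros)
    moreover have "c \<noteq> 0"
      using nz[of a] by (simp add: c_def sgn_zero_iff)
    ultimately show False
      using nz by auto
  qed
  then have "0 < c * bessel_series 1 t" if "a \<le> t" for t
    using that by (intro bessel_series_eventually_pos_lower[of a c 1 t]) (auto simp: a_def numeral_2_eq_2)
  then show False
    using bessel_series_1_not_eventually_pos[of a c] by (force simp: a_def)
qed

subsection \<open>The positive zeros of \<open>J\<^sub>2\<close>\<close>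

text \<open>Existence of the \<open>n\<close>-th zero in abstract form: passing to the next element
  beyond \<open>b\<close> raises the count by one.\<close>

lemma nth_element_exists:
  fixes Z :: "real set"
  assumes pos: "\<And>t. t \<in> Z \<Longrightarrow> 0 < t"
    and fin: "\<And>b. finite {t \<in> Z. t \<le> b}" and unb: "\<And>b. \<exists>t\<in>Z. b < t"
  shows "\<exists>x\<in>Z. card {t \<in> Z. t \<le> x} = Suc n"
proof -
  have step: "\<exists>x\<in>Z. card {t \<in> Z. t \<le> x} = Suc (card {t \<in> Z. t \<le> b})" for b
  proof -
    obtain c where c: "c \<in> Z" "b < c"
      using unb by blast
    \<comment> \<open>Cutting off at some element \<open>c\<close> leaves a finite set, so the next
      element is a minimum.\<close>
    define A where "A = {t \<in> Z. b < t \<and> t \<le> c}"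
    have "finite A"
      by (rule finite_subset[OF _ fin[of c]]) (auto simp: A_def)
    moreover have "A \<noteq> {}"
      using c by (auto simp: A_def)
    ultimately have m: "Min A \<in> A" "\<And>t. t \<in> A \<Longrightarrow> Min A \<le> t"
      by auto
    have "{t \<in> Z. t \<le> Min A} = insert (Min A) {t \<in> Z. t \<le> b}"
      using m by (fastforce simp: A_def)
    moreover have "Min A \<notin> {t \<in> Z. t \<le> b}"
      using m(1) by (auto simp: A_def)
    ultimately show ?thesis
      using m(1) fin by (intro bexI[of _ "Min A"]) (auto simp: A_def)
  qed
  show ?thesis
  proof (induction n)
    case 0
    have "{t \<in> Z. t \<le> 0} = {}"
      using pos by force
    with step[of 0] show ?case
      by simp
  next
    case (Suc n)
    then show ?case
      using step by metis
  qed
qed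

text \<open>The uniqueness half: the count up to \<open>v\<close> exceeds every earlier count when
  \<open>v\<close> lies in \<open>Z\<close>.\<close>

lemma card_le_inj:
  fixes Z :: "real set"
  assumes fin: "\<And>b. finite {t \<in> Z. t \<le> b}"
    and "x \<in> Z" "y \<in> Z" "card {t \<in> Z. t \<le> x} = card {t \<in> Z. t \<le> y}"
  shows "x = y"
proof -
  have less: "card {t \<in> Z. t \<le> u} < card {t \<in> Z. t \<le> v}" if "u < v" "v \<in> Z" for u v
    using that fin[of v] by (intro psubset_card_mono psubsetI) (auto simp: set_eq_iff intro: exI[of _ v])
  show ?thesis
    using less[of x y] less[of y x] assms by (cases x y rule: linorder_cases) auto
qed

text \<open>This justifies the definite description \<open>bessel_J_zero\<close>. On the positive
  axis \<open>t^2 / 4\<close> is injective and transfers finiteness and unboundedness of the zeros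
  from \<open>bessel_series 2\<close>.\<close>

lemma bessel_J_zero_2:
  assumes "1 \<le> n"
  shows "0 < bessel_J_zero 2 n" "bessel_J 2 (bessel_J_zero 2 n) = 0"
proof -
  let ?Z = "{t. 0 < t \<and> bessel_J 2 t = 0}"
  have iff: "bessel_J 2 t = 0 \<longleftrightarrow> bessel_series 2 (t\<^sup>2 / 4) = 0" if "0 < t" for t
    using that by (simp add: bessel_J_eq)
  have fin: "finite {t \<in> ?Z. t \<le> b}" for b
  proof (rule inj_on_finite)
    show "inj_on (\<lambda>t. t\<^sup>2 / 4) {t \<in> ?Z. t \<le> b}"
      by (auto simp: inj_on_def power2_eq_iff)
    show "(\<lambda>t. t\<^sup>2 / 4) ` {t \<in> ?Z. t \<le> b} \<subseteq> {t. 0 \<le> t \<and> t \<le> b\<^sup>2 / 4 \<and> bessel_series 2 t = 0}"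
      by (auto simp: iff intro!: power_mono)
  qed (rule finite_zeros_bessel_series_2)
  have unb: "\<exists>t\<in>?Z. b < t" for b
  proof -
    obtain t where t: "(\<bar>b\<bar> + 1)\<^sup>2 \<le> t" "bessel_series 2 t = 0"
      using bessel_series_2_zeros_unbounded by blast
    have "\<bar>b\<bar> + 1 \<le> sqrt t"
      using t(1) by (rule real_le_rsqrt)
    then have "b < 2 * sqrt t" "0 < 2 * sqrt t"
      by linarith+
    moreover from this have "0 < t"
      by simp
    ultimately show ?thesis
      using t(2) iff[of "2 * sqrt t"] by (intro bexI[of _ "2 * sqrt t"]) (auto simp: power_mult_distrib)
  qed
  let ?P = "\<lambda>x. 0 < x \<and> bessel_J 2 x = 0 \<and> card {t. 0 < t \<and> t \<le> x \<and> bessel_J 2 t = 0} = n"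
  have card: "{t. 0 < t \<and> t \<le> x \<and> bessel_J 2 t = 0} = {t \<in> ?Z. t \<le> x}" for x
    by auto
  \<comment> \<open>Here \<open>1 \<le> n\<close> enters: it gives
    \<open>Suc (n - 1) = n\<close>.\<close>
  have "\<exists>x\<in>?Z. card {t \<in> ?Z. t \<le> x} = Suc (n - 1)"
    using fin unb by (intro nth_element_exists) auto
  then obtain x where x: "?P x"
    using assms unfolding card by auto
  have "?P (bessel_J_zero 2 n)"
    unfolding bessel_J_zero_def
  proof (rule theI[of ?P x])
    show "y = x" if "?P y" for y
      using that x unfolding card by (intro card_le_inj[OF fin]) auto
  qed (rule x)
  then show "0 < bessel_J_zero 2 n" "bessel_J 2 (bessel_J_zero 2 n) = 0"
    by auto
qed

subsection \<open>Rotation invariance of the plane measure\<close>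

text \<open>By Tonelli: for fixed \<open>y\<close> the shear is a translation by
  \<open>m * y\<close> in \<open>x\<close>.\<close>

lemma distr_lborel_shear:
  fixes m :: real
  shows "distr lborel borel (\<lambda>(x, y). (x + m * y, y)) = (lborel :: (real \<times> real) measure)"
proof (rule measure_eqI)
  let ?T = "\<lambda>(x, y). (x + m * y, y :: real)"
  fix A :: "(real \<times> real) set"
  assume "A \<in> sets (distr lborel borel ?T)"
  then have [measurable]: "A \<in> sets borel"
    by simp
  have [measurable]: "?T \<in> borel \<rightarrow>\<^sub>M borel"
    unfolding borel_prod[symmetric] by measurable
  have [measurable]: "(\<lambda>p. indicator A p :: ennreal) \<in> borel_measurable (lborel \<Otimes>\<^sub>M lborel)"
    "(\<lambda>p. indicator A (?T p) :: ennreal) \<in> borel_measurable (lborel \<Otimes>\<^sub>M lborel)"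
    unfolding lborel_prod by simp_all
  have "emeasure (distr lborel borel ?T) A = (\<integral>\<^sup>+ p. indicator A (?T p) \<partial>lborel)"
    using nn_integral_distr[of ?T lborel borel "indicator A"]
      nn_integral_indicator[of A "distr lborel borel ?T"] by simp
  also have "\<dots> = (\<integral>\<^sup>+ p. indicator A (?T p) \<partial>(lborel \<Otimes>\<^sub>M lborel))"
    by (simp add: lborel_prod)
  also have "\<dots> = (\<integral>\<^sup>+ y. (\<integral>\<^sup>+ x. indicator A (m * y + 1 * x, y) \<partial>lborel) \<partial>lborel)"
    by (subst lborel_pair.nn_integral_snd[symmetric]) (auto simp: add.commute)
  also have "\<dots> = (\<integral>\<^sup>+ y. (\<integral>\<^sup>+ x. indicator A (x, y) \<partial>lborel) \<partial>lborel)"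
  proof (rule nn_integral_cong)
    fix y :: real
    show "(\<integral>\<^sup>+ x. indicator A (m * y + 1 * x, y) \<partial>lborel) = (\<integral>\<^sup>+ x. indicator A (x, y) \<partial>lborel)"
      using nn_integral_real_affine[of "\<lambda>x. indicator A (x, y)" 1 "m * y"] by simp
  qed
  also have "\<dots> = (\<integral>\<^sup>+ p. indicator A p \<partial>(lborel \<Otimes>\<^sub>M lborel))"
    by (subst lborel_pair.nn_integral_snd[symmetric]) auto
  also have "\<dots> = emeasure lborel A"
    by (simp add: lborel_prod)
  finally show "emeasure (distr lborel borel ?T) A = emeasure lborel A" .
qed simp

lemma distr_lborel_swap:
  "distr lborel borel (\<lambda>(x, y). (y, x)) = (lborel :: (real \<times> real) measure)"
proof -
  show ?thesis
    using lborel_pair.distr_pair_swap[where ?'a = real and ?'b = real] unfolding lborel_prod by (simp cong: distr_cong)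
qed

text \<open>Conjugation of the other shear by the coordinate swap.\<close>

lemma distr_lborel_shear':
  fixes m :: real
  shows "distr lborel borel (\<lambda>(x, y). (x, y + m * x)) = (lborel :: (real \<times> real) measure)"
proof -
  let ?S = "\<lambda>(x :: real, y :: real). (y, x)" and ?T = "\<lambda>(x, y). (x + m * y, y :: real)"
  have [measurable]: "?S \<in> borel \<rightarrow>\<^sub>M borel" "?T \<in> borel \<rightarrow>\<^sub>M borel"
    unfolding borel_prod[symmetric] by (measurable, measurable)
  have "distr (distr (distr lborel borel ?S) borel ?T) borel ?S = (lborel :: (real \<times> real) measure)"
    by (simp only: distr_lborel_swap distr_lborel_shear)
  moreover have "?S \<circ> (?T \<circ> ?S) = (\<lambda>(x, y). (x, y + m * x))"
    by auto
  ultimately show ?thesis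
    by (simp add: distr_distr del: comp_apply)
qed

lemma distr_lborel_rotation:
  fixes c s :: real
  assumes cs: "c\<^sup>2 + s\<^sup>2 = 1"
  shows "distr lborel borel (\<lambda>(x, y). (c * x - s * y, s * x + c * y)) = (lborel :: (real \<times> real) measure)"
\<comment> \<open>At the half turn the shear factor \<open>- s / (1 + c)\<close> degenerates; there
  the map is the reflection through the origin.\<close>
proof (cases "c = -1")
  case True
  with cs have "s = 0"
    by simp
  have "(lborel :: (real \<times> real) measure) = density (distr lborel borel (\<lambda>p. 0 + (-1) *\<^sub>R p)) (\<lambda>_. \<bar>-1::real\<bar> ^ DIM(real \<times> real))"
    by (rule lborel_affine) simp
  also have "(\<lambda>p. 0 + (-1) *\<^sub>R p) = (\<lambda>(x, y). (c * x - s * y, s * x + c * y))"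
    using True \<open>s = 0\<close> by auto
  finally show ?thesis
    by (simp add: density_1)
next
  case False
  txt \<open>A rotation by any other angle \<open>\<theta>\<close> is a product of three shears; here \<open>m = - tan (\<theta> / 2)\<close>.\<close>
  define m where "m = - s / (1 + c)"
  let ?T = "\<lambda>(x, y). (x + m * y, y :: real)" and ?U = "\<lambda>(x, y). (x, y + s * x)"
  have [measurable]: "?T \<in> borel \<rightarrow>\<^sub>M borel" "?U \<in> borel \<rightarrow>\<^sub>M borel"
    unfolding borel_prod[symmetric] by (measurable, measurable)
  have "1 + c \<noteq> 0"
    using False by linarith
  \<comment> \<open>\<open>ms\<close> and \<open>mc\<close> evaluate the entries of the product of
    shears: \<open>1 + m * s = c\<close> and
    \<open>2 * m + m * m * s = m * (1 + c) = - s\<close>.\<close>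
  have ms: "m * s = c - 1"
  proof -
    have "s * s = (1 - c) * (1 + c)"
      using cs by (simp add: algebra_simps power2_eq_square)
    then show ?thesis
      using \<open>1 + c \<noteq> 0\<close> by (simp add: m_def field_simps)
  qed
  have mc: "m * (1 + c) = - s"
    using \<open>1 + c \<noteq> 0\<close> by (simp add: m_def)
  have "distr (distr (distr lborel borel ?T) borel ?U) borel ?T = (lborel :: (real \<times> real) measure)"
    by (simp only: distr_lborel_shear' distr_lborel_shear)
  moreover have "?T \<circ> (?U \<circ> ?T) = (\<lambda>(x, y). (c * x - s * y, s * x + c * y))"
  proof (intro ext, clarsimp, intro conjI)
    fix x y
    have "x + m * y + m * (y + s * (x + m * y)) = x + m * s * x + (m + m + m * s * m) * y"
      by (simp add: algebra_simps)
    also have "\<dots> = c * x + m * (1 + c) * y"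
      unfolding ms by (simp add: algebra_simps)
    finally show "x + m * y + m * (y + s * (x + m * y)) = c * x - s * y"
      unfolding mc by simp
    have "y + s * (x + m * y) = s * x + (1 + m * s) * y"
      by (simp add: algebra_simps)
    then show "y + s * (x + m * y) = s * x + c * y"
      unfolding ms by simp
  qed
  ultimately show ?thesis
    by (simp add: distr_distr del: comp_apply)
qed

subsection \<open>Integrals over the disc\<close>

definition semicircle_moment :: "real \<Rightarrow> nat \<Rightarrow> real" where
  "semicircle_moment R k = integral {- R..R} (\<lambda>x. x ^ (2 * k) * sqrt (R\<^sup>2 - x\<^sup>2))"

lemma semicircle_moment_has_integral:
  "((\<lambda>x. x ^ (2 * k) * sqrt (R\<^sup>2 - x\<^sup>2)) has_integral semicircle_moment R k) {- R..R}"
  unfolding semicircle_moment_def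
  by (intro integrable_integral integrable_continuous_real continuous_intros)

lemma semicircle_moment_Suc:
  assumes "0 \<le> R"
  shows "real (2 * k + 4) * semicircle_moment R (Suc k) = real (2 * k + 1) * R\<^sup>2 * semicircle_moment R k"
  \<comment> \<open>integration by parts with \<open>x\<^bsup>2k+1\<^esup> (R\<^sup>2 - x\<^sup>2)\<^bsup>3/2\<^esup>\<close>, which vanishes at \<open>\<plusminus> R\<close>\<close>
proof -
  define F where "F x = x ^ (2 * k + 1) * ((R\<^sup>2 - x\<^sup>2) * sqrt (R\<^sup>2 - x\<^sup>2))" for x
  define f where "f x = real (2 * k + 1) * R\<^sup>2 * (x ^ (2 * k) * sqrt (R\<^sup>2 - x\<^sup>2))
    - real (2 * k + 4) * (x ^ (2 * Suc k) * sqrt (R\<^sup>2 - x\<^sup>2))" for x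
  have ftc: "(f has_integral (F R - F (- R))) {- R..R}"
  \<comment> \<open>The derivative is computed through \<open>sqrt\<close>, which is not
    differentiable at 0, so the endpoints are left to continuity.\<close>
  proof (rule fundamental_theorem_of_calculus_interior)
    show "continuous_on {- R..R} F"
      unfolding F_def by (intro continuous_intros)
    fix x assume "x \<in> {- R<..<R}"
    then have "\<bar>x\<bar> < \<bar>R\<bar>"
      by auto
    then have pos: "0 < R\<^sup>2 - x\<^sup>2"
      using power_strict_mono[of "\<bar>x\<bar>" "\<bar>R\<bar>" 2] by simp
    define s where "s = sqrt (R\<^sup>2 - x\<^sup>2)"
    have "0 < s" and ss: "R\<^sup>2 - x\<^sup>2 = s * s"
      using pos by (simp_all add: s_def)
    have "((\<lambda>x. (R\<^sup>2 - x\<^sup>2) * sqrt (R\<^sup>2 - x\<^sup>2)) has_real_derivative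
        (R\<^sup>2 - x\<^sup>2) * (- x / s) - 2 * x * s) (at x)"
      unfolding s_def using pos by (auto intro!: derivative_eq_intros simp: field_simps)
    from DERIV_mult[OF DERIV_pow[of "2 * k + 1"] this]
    have "(F has_real_derivative real (2 * k + 1) * x ^ (2 * k) * ((R\<^sup>2 - x\<^sup>2) * s)
        + x ^ (2 * k + 1) * ((R\<^sup>2 - x\<^sup>2) * (- x / s) - 2 * x * s)) (at x)"
      unfolding F_def[abs_def] s_def by (simp add: mult_ac add_ac)
    also have "(R\<^sup>2 - x\<^sup>2) * (- x / s) = - x * s"
      using \<open>0 < s\<close> unfolding ss by simp
    also have "real (2 * k + 1) * x ^ (2 * k) * ((R\<^sup>2 - x\<^sup>2) * s) + x ^ (2 * k + 1) * (- x * s - 2 * x * s) = f x"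
      unfolding f_def s_def[symmetric] by (simp add: algebra_simps power2_eq_square)
    finally show "(F has_vector_derivative f x) (at x)"
      by (simp add: has_real_derivative_iff_has_vector_derivative)
  qed (use assms in auto)
  moreover have "F R = 0" "F (- R) = 0"
    by (simp_all add: F_def)
  moreover have "(f has_integral (real (2 * k + 1) * R\<^sup>2 * semicircle_moment R k
      - real (2 * k + 4) * semicircle_moment R (Suc k))) {- R..R}"
    unfolding f_def[abs_def]
    by (intro has_integral_diff has_integral_mult_right semicircle_moment_has_integral)
  ultimately show ?thesis
    using has_integral_unique[OF ftc] by fastforce
qed

text \<open>The moment recursion, divided by the growth of \<open>(2k)!\<close>, has the factor
  \<open>(R^2 / 4) / ((k + 1) * (k + 2))\<close>, as do the coefficients of
  \<open>bessel_series 1\<close> up to sign.\<close>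

lemma semicircle_moment_eq:
  assumes "0 \<le> R"
  shows "semicircle_moment R k / fact (2 * k) = semicircle_moment R 0 * (R\<^sup>2 / 4) ^ k / (fact k * fact (k + 1))"
proof (induction k)
  case (Suc k)
  have "semicircle_moment R (Suc k) = real (2 * k + 1) * R\<^sup>2 * semicircle_moment R k / real (2 * k + 4)"
    using semicircle_moment_Suc[OF assms, of k] by (simp add: field_simps)
  moreover have "fact (2 * Suc k) = (real (2 * k + 2) * (real (2 * k + 1) * fact (2 * k)) :: real)"
    by simp
  ultimately have "semicircle_moment R (Suc k) / fact (2 * Suc k)
      = R\<^sup>2 / (real (2 * k + 2) * real (2 * k + 4)) * (semicircle_moment R k / fact (2 * k))"
    by (simp del: fact_Suc)
  also have "\<dots> = R\<^sup>2 / (4 * (real (k + 1) * real (k + 2))) *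
      (semicircle_moment R 0 * (R\<^sup>2 / 4) ^ k / (fact k * fact (k + 1)))"
    unfolding Suc.IH by (simp add: algebra_simps)
  also have "\<dots> = semicircle_moment R 0 * (R\<^sup>2 / 4) ^ Suc k /
      ((real (k + 1) * fact k) * (real (k + 2) * fact (k + 1)))"
    by (simp add: mult_ac)
  also have "(real (k + 1) * fact k) * (real (k + 2) * fact (k + 1)) = (fact (Suc k) * fact (Suc k + 1) :: real)"
    by simp
  finally show ?case .
qed simp

text \<open>In essence Poisson's integral for \<open>J\<^sub>1\<close>: the cosine series is
  integrated term by term, and the moments supply the coefficients.\<close>

lemma semicircle_cos_has_integral:
  assumes "0 \<le> R"
  shows "((\<lambda>x. cos (c * x) * sqrt (R\<^sup>2 - x\<^sup>2)) has_integral
    semicircle_moment R 0 * bessel_series 1 ((c * R)\<^sup>2 / 4)) {- R..R}"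
proof -
  define f where "f k x = (- 1) ^ k / fact (2 * k) * (c * x) ^ (2 * k) * sqrt (R\<^sup>2 - x\<^sup>2)" for k x
  have sums: "(\<lambda>k. f k x) sums (cos (c * x) * sqrt (R\<^sup>2 - x\<^sup>2))" for x
    unfolding f_def by (intro sums_mult2 cos_paired)
  have "uniform_limit {- R..R} (\<lambda>n x. \<Sum>k<n. f k x) (\<lambda>x. \<Sum>k. f k x) sequentially"
  proof (rule Weierstrass_m_test)
    \<comment> \<open>Weakening \<open>(2k)!\<close> to \<open>k!\<close> gives an exponential
      series as majorant on the whole interval.\<close>
    show "summable (\<lambda>k. R * (((c * R)\<^sup>2) ^ k /\<^sub>R fact k))"
      by (intro summable_mult summable_exp_generic)
    fix k x assume "x \<in> {- R..R}"
    then have x: "x\<^sup>2 \<le> R\<^sup>2"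
      by (simp add: abs_le_square_iff[symmetric] abs_le_iff)
    have "norm (f k x) = (c\<^sup>2 * x\<^sup>2) ^ k / fact (2 * k) * sqrt (R\<^sup>2 - x\<^sup>2)"
      using x by (simp add: f_def abs_mult power_mult power_mult_distrib)
    also have "\<dots> \<le> (c\<^sup>2 * R\<^sup>2) ^ k / fact k * R"
    proof (rule mult_mono)
      show "(c\<^sup>2 * x\<^sup>2) ^ k / fact (2 * k) \<le> (c\<^sup>2 * R\<^sup>2) ^ k / fact k"
        using mult_left_mono[OF x, of "c\<^sup>2"] by (intro frac_le power_mono) (auto intro: fact_mono)
      show "sqrt (R\<^sup>2 - x\<^sup>2) \<le> R"
        using assms by (intro real_le_lsqrt) auto
    qed (use x in auto)
    finally show "norm (f k x) \<le> R * (((c * R)\<^sup>2) ^ k /\<^sub>R fact k)"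
      by (simp add: power_mult_distrib divide_inverse mult_ac)
  qed
  then obtain I J where I: "\<And>n. ((\<lambda>x. \<Sum>k<n. f k x) has_integral I n) {- R..R}"
    and J: "((\<lambda>x. \<Sum>k. f k x) has_integral J) {- R..R}" and lim: "I \<longlonglongrightarrow> J"
    by (rule uniform_limit_integral)
      (auto simp: f_def intro!: continuous_intros)
  let ?c = "\<lambda>k. semicircle_moment R 0 * ((-1) ^ k / (fact k * fact (k + 1)) * ((c * R)\<^sup>2 / 4) ^ k)"
  have "(f k has_integral ?c k) {- R..R}" for k
  proof -
    have "(f k has_integral (- 1) ^ k * c ^ (2 * k) / fact (2 * k) * semicircle_moment R k) {- R..R}"
      using has_integral_mult_right[OF semicircle_moment_has_integral[of k R], of "(- 1) ^ k * c ^ (2 * k) / fact (2 * k)"]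
      unfolding f_def[abs_def] by (simp add: power_mult_distrib mult_ac)
    also have "(- 1) ^ k * c ^ (2 * k) / fact (2 * k) * semicircle_moment R k
        = (- 1) ^ k * c ^ (2 * k) * (semicircle_moment R k / fact (2 * k))"
      by simp
    also have "\<dots> = ?c k"
      unfolding semicircle_moment_eq[OF assms]
      by (simp add: power_mult_distrib power_divide mult_ac flip: power_mult)
    finally show ?thesis .
  qed
  then have "((\<lambda>x. \<Sum>k<n. f k x) has_integral (\<Sum>k<n. ?c k)) {- R..R}" for n
    by (intro has_integral_sum) auto
  then have "I = (\<lambda>n. \<Sum>k<n. ?c k)"
    by (intro ext has_integral_unique[OF I])
  with lim have "?c sums J"
    by (simp add: sums_def)
  moreover have "?c sums (semicircle_moment R 0 * bessel_series 1 ((c * R)\<^sup>2 / 4))"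
    unfolding bessel_series_def by (intro sums_mult summable_sums summable_bessel_series)
  ultimately have "J = semicircle_moment R 0 * bessel_series 1 ((c * R)\<^sup>2 / 4)"
    by (rule sums_unique2)
  with J show ?thesis
    using sums by (simp add: sums_iff)
qed

lemma circular_surface_eq_cball:
  assumes "0 \<le> R"
  shows "circular_surface R = cball 0 R"
proof -
  have "x\<^sup>2 + y\<^sup>2 \<le> R\<^sup>2 \<longleftrightarrow> sqrt (x\<^sup>2 + y\<^sup>2) \<le> R" for x y
    using assms by (metis real_sqrt_le_iff real_sqrt_unique sqrt_le_D)
  then show ?thesis
    by (auto simp: circular_surface_def norm_Pair)
qed

lemma set_integrable_circular_surface:
  fixes f :: "real \<times> real \<Rightarrow> 'b::{banach, second_countable_topology}"
  assumes "0 \<le> R" and "continuous_on UNIV f"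
  shows "set_integrable lborel (circular_surface R) f"
  unfolding set_integrable_def circular_surface_eq_cball[OF \<open>0 \<le> R\<close>]
  using assms(2) by (intro borel_integrable_compact) (auto intro: continuous_on_subset)

lemma circular_surface_integral_cos_fst:
  assumes "0 \<le> R"
  shows "(LINT p:circular_surface R|lborel. cos (c * fst p))
    = 2 * semicircle_moment R 0 * bessel_series 1 ((c * R)\<^sup>2 / 4)"
proof -
  let ?S = "circular_surface R"
  let ?f = "\<lambda>p. indicator ?S p *\<^sub>R cos (c * fst p)"
  have int: "integrable (lborel \<Otimes>\<^sub>M lborel) ?f"
    unfolding lborel_prod set_integrable_def[symmetric]
    by (intro set_integrable_circular_surface assms continuous_intros)
  \<comment> \<open>The integrand is constant along the vertical chord at \<open>x\<close>, whose
    length is \<open>2 * sqrt (R^2 - x^2)\<close>.\<close>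
  have inner: "(LINT y|lborel. ?f (x, y)) = indicator {- R..R} x *\<^sub>R (2 * (cos (c * x) * sqrt (R\<^sup>2 - x\<^sup>2)))" for x
  proof (cases "x \<in> {- R..R}")
    case True
    then have x: "x\<^sup>2 \<le> R\<^sup>2"
      by (simp add: abs_le_square_iff[symmetric] abs_le_iff)
    have "x\<^sup>2 + y\<^sup>2 \<le> R\<^sup>2 \<longleftrightarrow> - sqrt (R\<^sup>2 - x\<^sup>2) \<le> y \<and> y \<le> sqrt (R\<^sup>2 - x\<^sup>2)" for y
      using real_sqrt_le_iff[of "y\<^sup>2" "R\<^sup>2 - x\<^sup>2"] by (auto simp: abs_le_iff)
    then have "indicator ?S (x, y) = (indicator {- sqrt (R\<^sup>2 - x\<^sup>2)..sqrt (R\<^sup>2 - x\<^sup>2)} y :: real)" for y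
      by (auto simp: circular_surface_def indicator_def)
    then show ?thesis
      using True x by simp
  next
    case False
    then have "\<bar>R\<bar> < \<bar>x\<bar>"
      using assms by auto
    then have "R\<^sup>2 < x\<^sup>2"
      using power_strict_mono[of "\<bar>R\<bar>" "\<bar>x\<bar>" 2] by simp
    then have "\<not> x\<^sup>2 + y\<^sup>2 \<le> R\<^sup>2" for y
      using zero_le_power2[of y] by linarith
    then have "(x, y) \<notin> ?S" for y
      by (simp add: circular_surface_def)
    with False show ?thesis
      by simp
  qed
  have "(LINT p:?S|lborel. cos (c * fst p)) = (LINT x|lborel. LINT y|lborel. ?f (x, y))"
    unfolding lborel_pair.integral_fst'[OF int] by (simp add: set_lebesgue_integral_def lborel_prod)
  also have "\<dots> = (LINT x:{- R..R}|lborel. 2 * (cos (c * x) * sqrt (R\<^sup>2 - x\<^sup>2)))"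
    unfolding inner set_lebesgue_integral_def ..
  also have "\<dots> = integral {- R..R} (\<lambda>x. 2 * (cos (c * x) * sqrt (R\<^sup>2 - x\<^sup>2)))"
    by (intro set_borel_integral_eq_integral(2) borel_integrable_atLeastAtMost' continuous_intros)
  also have "\<dots> = 2 * (semicircle_moment R 0 * bessel_series 1 ((c * R)\<^sup>2 / 4))"
    by (intro integral_unique has_integral_mult_right semicircle_cos_has_integral assms)
  finally show ?thesis
    by simp
qed

lemma circular_surface_integral_rotation:
  fixes f :: "real \<times> real \<Rightarrow> 'b::{banach, second_countable_topology}"
  assumes "c\<^sup>2 + s\<^sup>2 = 1" and [measurable]: "f \<in> borel_measurable borel"
  shows "(LINT p:circular_surface R|lborel. f (c * fst p - s * snd p, s * fst p + c * snd p))
    = (LINT p:circular_surface R|lborel. f p)"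
proof -
  let ?T = "\<lambda>(x, y). (c * x - s * y, s * x + c * y)"
  have [measurable]: "?T \<in> borel \<rightarrow>\<^sub>M borel"
    unfolding borel_prod[symmetric] by measurable
  have "closed (circular_surface R)"
    unfolding circular_surface_def case_prod_beta
    by (intro closed_Collect_le continuous_intros)
  then have [measurable]: "circular_surface R \<in> sets borel"
    by simp
  have "(c * x - s * y)\<^sup>2 + (s * x + c * y)\<^sup>2 = (c\<^sup>2 + s\<^sup>2) * (x\<^sup>2 + y\<^sup>2)" for x y
    by (simp add: algebra_simps power2_eq_square)
  then have S: "?T p \<in> circular_surface R \<longleftrightarrow> p \<in> circular_surface R" for p
    using assms(1) by (auto simp: circular_surface_def)
  have "(LINT p:circular_surface R|lborel. f p) =
      (LINT p|distr lborel borel ?T. indicator (circular_surface R) p *\<^sub>R f p)"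
    unfolding distr_lborel_rotation[OF assms(1)] set_lebesgue_integral_def ..
  also have "\<dots> = (LINT p|lborel. indicator (circular_surface R) (?T p) *\<^sub>R f (?T p))"
    by (rule integral_distr) measurable
  also have "\<dots> = (LINT p:circular_surface R|lborel. f (?T p))"
    unfolding set_lebesgue_integral_def indicator_def S ..
  finally show ?thesis
    by (simp add: case_prod_beta)
qed

lemma circular_surface_integral_cos:
  assumes "0 \<le> R"
  shows "(LINT p:circular_surface R|lborel. cos (a * fst p + b * snd p))
    = 2 * semicircle_moment R 0 * bessel_series 1 ((a\<^sup>2 + b\<^sup>2) * R\<^sup>2 / 4)"
proof -
  define r where "r = sqrt (a\<^sup>2 + b\<^sup>2)"
  have r2: "r\<^sup>2 = a\<^sup>2 + b\<^sup>2"
    by (simp add: r_def)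
  \<comment> \<open>The rotation aligns \<open>(a, b)\<close> with the first axis; the minus sign
    matches the first coordinate \<open>c * x - s * y\<close>. For \<open>(a, b) = 0\<close> the
    identity serves.\<close>
  obtain c s where cs: "c\<^sup>2 + s\<^sup>2 = 1" "a = r * c" "b = - (r * s)"
  proof (cases "r = 0")
    case True
    with r2 have "a = 0" "b = 0"
      by (simp_all add: sum_power2_eq_zero_iff)
    with True show ?thesis
      by (intro that[of 1 0]) auto
  next
    case False
    then show ?thesis
      using r2 by (intro that[of "a / r" "- b / r"]) (auto simp: power_divide add_divide_distrib[symmetric])
  qed
  have "(LINT p:circular_surface R|lborel. cos (a * fst p + b * snd p))
      = (LINT p:circular_surface R|lborel. cos (r * fst (c * fst p - s * snd p, s * fst p + c * snd p)))"
    by (simp add: cs algebra_simps)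
  also have "\<dots> = (LINT p:circular_surface R|lborel. cos (r * fst p))"
    using cs(1) by (intro circular_surface_integral_rotation) (auto simp flip: borel_prod)
  also have "\<dots> = 2 * semicircle_moment R 0 * bessel_series 1 ((a\<^sup>2 + b\<^sup>2) * R\<^sup>2 / 4)"
    using assms by (simp add: circular_surface_integral_cos_fst power_mult_distrib r2)
  finally show ?thesis .
qed

lemma circular_surface_integral_cis:
  assumes "0 \<le> R"
  shows "(LINT p:circular_surface R|lborel. cis (a * fst p + b * snd p))
    = of_real (2 * semicircle_moment R 0 * bessel_series 1 ((a\<^sup>2 + b\<^sup>2) * R\<^sup>2 / 4))"
proof -
  let ?u = "\<lambda>p. a * fst p + b * snd p"
  have int: "set_integrable lborel (circular_surface R) (\<lambda>p. cos (?u p))"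
    "set_integrable lborel (circular_surface R) (\<lambda>p. sin (?u p))"
    using assms by (auto intro!: set_integrable_circular_surface continuous_intros)
  \<comment> \<open>The half turn \<open>c = -1\<close>, \<open>s = 0\<close> preserves the disc and
    reverses the sign of the sine.\<close>
  have "(LINT p:circular_surface R|lborel. sin (?u p)) = (LINT p:circular_surface R|lborel. sin (?u (- fst p, - snd p)))"
    using circular_surface_integral_rotation[of "-1" 0 "\<lambda>p. sin (?u p)" R]
    by (simp flip: borel_prod)
  also have "\<dots> = - (LINT p:circular_surface R|lborel. sin (?u p))"
    by (subst set_integral_uminus[symmetric, OF int(2)]) (simp flip: sin_minus)
  finally have "(LINT p:circular_surface R|lborel. sin (?u p)) = 0"
    by simp
  moreover have "cis t = of_real (cos t) + \<i> * of_real (sin t)" for t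
    by (simp add: complex_eq_iff)
  moreover have "set_integrable lborel (circular_surface R) (\<lambda>p. complex_of_real (cos (?u p)))"
    "set_integrable lborel (circular_surface R) (\<lambda>p. \<i> * complex_of_real (sin (?u p)))"
    using assms by (auto intro!: set_integrable_circular_surface continuous_intros)
  ultimately show ?thesis
    using circular_surface_integral_cos[OF assms, of a b]
    by (simp add: set_integral_add set_integral_complex_of_real)
qed

section \<open>From the disc integral to the channel\<close>

lemma effective_channel_circular_surface:
  assumes "0 \<le> R"
  obtains \<theta> where "effective_channel \<kappa> (circular_surface R) k k' =
    cis \<theta> * of_real (2 * semicircle_moment R 0 * bessel_series 1 ((\<kappa> * R * chi_diff k k')\<^sup>2 / 4))"
proof -
  \<comment> \<open>The part of the phase difference that does not depend on \<open>p\<close>; the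
    rest is linear in \<open>p\<close>, with a frequency vector of squared length
    \<open>(\<kappa> * chi_diff k k')^2\<close>.\<close>
  define \<theta> where "\<theta> = \<kappa> * center_dist k + phase k - (\<kappa> * center_dist k' + phase k')"
  have "cnj (channel \<kappa> k p) * channel \<kappa> k' p =
      cis \<theta> * cis ((- \<kappa> * eta_diff k k') * fst p + (\<kappa> * xi_diff k k') * snd p)" for p
  proof -
    have exp_cis: "exp (- \<i> * complex_of_real t) = cis (- t)" for t
      by (simp add: cis_conv_exp)
    show ?thesis
      unfolding channel_def case_prod_beta exp_cis cis_cnj cis_mult
      by (rule arg_cong[of _ _ cis])
         (simp add: \<theta>_def eta_diff_def xi_diff_def algebra_simps diff_divide_distrib)
  qed
  moreover have "(- \<kappa> * eta_diff k k')\<^sup>2 + (\<kappa> * xi_diff k k')\<^sup>2 = (\<kappa> * chi_diff k k')\<^sup>2"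
    by (simp add: chi_diff_def power_mult_distrib algebra_simps)
  ultimately have "effective_channel \<kappa> (circular_surface R) k k' =
    cis \<theta> * of_real (2 * semicircle_moment R 0 * bessel_series 1 ((\<kappa> * chi_diff k k')\<^sup>2 * R\<^sup>2 / 4))"
    unfolding effective_channel_def
    using circular_surface_integral_cis[OF assms, of "- \<kappa> * eta_diff k k'" "\<kappa> * xi_diff k k'"]
    by simp
  then show ?thesis
    by (intro that[of \<theta>]) (simp add: power_mult_distrib mult_ac)
qed

text \<open>The phases have modulus 1, the denominator has \<open>bessel_series 1 0 = 1\<close>, and
  a nonzero moment cancels. The inequality also covers a vanishing moment, where
  \<open>x / 0 = 0\<close> makes the left side 0.\<close>

lemma normalized_channel_circular_surface_le:
  assumes "0 \<le> R"
  shows "normalized_channel \<kappa> (circular_surface R) k k' \<le> \<bar>bessel_series 1 ((\<kappa> * R * chi_diff k k')\<^sup>2 / 4)\<bar>"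
proof -
  obtain \<theta> where \<theta>: "effective_channel \<kappa> (circular_surface R) k k' =
    cis \<theta> * of_real (2 * semicircle_moment R 0 * bessel_series 1 ((\<kappa> * R * chi_diff k k')\<^sup>2 / 4))"
    using effective_channel_circular_surface[OF assms] .
  obtain \<theta>' where \<theta>': "effective_channel \<kappa> (circular_surface R) k k =
    cis \<theta>' * of_real (2 * semicircle_moment R 0 * bessel_series 1 ((\<kappa> * R * chi_diff k k)\<^sup>2 / 4))"
    using effective_channel_circular_surface[OF assms] .
  have "chi_diff k k = 0"
    by (simp add: chi_diff_def eta_diff_def xi_diff_def)
  then show ?thesis
    unfolding normalized_channel_def \<theta> \<theta>' by (simp add: norm_mult norm_divide abs_mult)
qed

theorem proposition2:
  fixes R \<kappa> :: real and n :: nat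
  assumes "0 < R" and "0 < \<kappa>" and "1 \<le> n"
  shows "spatial_resolution \<kappa> (circular_surface R) (resolution_threshold n)
           (bessel_J_zero 2 n / (\<kappa> * R))"
proof -
  define u where "u = bessel_J_zero 2 n"
  have "0 < u" and zero: "bessel_series 2 (u\<^sup>2 / 4) = 0"
    using bessel_J_zero_2[OF \<open>1 \<le> n\<close>] by (auto simp: u_def bessel_J_eq)
  \<comment> \<open>The factor \<open>u / 2\<close> in \<open>J\<^sub>1(u)\<close> cancels against
    \<open>2 / u\<close>.\<close>
  have threshold: "resolution_threshold n = \<bar>bessel_series 1 (u\<^sup>2 / 4)\<bar>"
    using \<open>0 < u\<close> by (simp add: resolution_threshold_def bessel_J_eq abs_mult flip: u_def)
  have "normalized_channel \<kappa> (circular_surface R) k k' < resolution_threshold n"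
    if "bessel_J_zero 2 n / (\<kappa> * R) < chi_diff k k'" for k k'
  proof -
    have "u < \<kappa> * R * chi_diff k k'"
      using that assms(1,2) by (simp add: u_def field_simps)
    then have "u\<^sup>2 / 4 < (\<kappa> * R * chi_diff k k')\<^sup>2 / 4"
      using \<open>0 < u\<close> by (simp add: power_strict_mono)
    then have "\<bar>bessel_series 1 ((\<kappa> * R * chi_diff k k')\<^sup>2 / 4)\<bar> < resolution_threshold n"
      unfolding threshold by (intro bessel_series_1_decay zero) auto
    with normalized_channel_circular_surface_le[of R \<kappa> k k'] \<open>0 < R\<close> show ?thesis
      by simp
  qed
  moreover have "0 < resolution_threshold n"
    unfolding threshold using bessel_series_1_neq_0[OF _ zero] by simp
  ultimately show ?thesis
    unfolding spatial_resolution_def by blast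
qed

end
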